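(* Let $D$ be a strongly connected digraph on the vertex set $[n]$ such that $\gcd\{c_1,\ldots,c_n\}=1$. Then $P_D$ is reflexive if and only if $c_i$ divides $c(D)$ for all $i\in[n]$.
   Context: A digraph $D$ is a finite directed graph on the vertex set $[n]=\{1,\ldots,n\}$, without loops and without isolated vertices (vertices with indegree and outdegree both zero); multiple directed edges are allowed. A directed edge $(i,j)$ has tail $i$ and head $j$. $D$ is strongly connected if it contains a directed path from $i$ to $j$ for every pair of vertices $i,j$. Let $a_{i,j}$ be the number of edges with tail $i$ and head $j$ (so $a_{i,i}=0$), and let $\mathrm{outdeg}(i)=\sum_j a_{i,j}$. The Laplacian matrix of $D$ is $L(D)=O(D)-A(D)$, where $A(D)=(a_{i,j})$ and $O(D)$ is the diagonal matrix with entries $\mathrm{outdeg}(i)$. The Laplacian polytope of $D$ is $P_D=\operatorname{conv}\{\mathbf{v}_1,\ldots,\mathbf{v}_n\}\subset\mathbb{R}^n$, where $\mathbf{v}_i$ is the $i$-th row of $L(D)$. It lies in the hyperplane $H=\{\mathbf{x}\in\mathbb{R}^n:\sum_i x_i=0\}$ and is regarded as a lattice polytope with respect to the lattice $H\cap\mathbb{Z}^n$; deleting any one column of $L(D)$ and taking the convex hull of the rows gives a unimodularly equivalent copy of $P_D$ in $\mathbb{R}^{n-1}$ with lattice $\mathbb{Z}^{n-1}$. A converging tree is a digraph whose underlying undirected graph is connected and that has one vertex of outdegree zero (its root), all other vertices having outdegree one. A subgraph of $D$ is spanning if its vertex set is $[n]$. Let $c_i$ be the number of spanning converging trees of $D$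 with root $i$ (parallel edges are regarded as distinct), and $c(D)=\sum_{i=1}^n c_i$. A full-dimensional lattice polytope $P\subset\mathbb{R}^d$ (vertices in $\mathbb{Z}^d$) containing the origin in its interior is reflexive if its dual $P^*=\{\mathbf{x}\in\mathbb{R}^d:\mathbf{x}\cdot\mathbf{y}\le 1\text{ for all }\mathbf{y}\in P\}$ is again a lattice polytope. More generally, every lattice polytope unimodularly equivalent (via an affine isomorphism of lattices) to such a $P$ is called reflexive. *)

theory Defs
  imports "HOL-Analysis.Analysis" "Graph_Theory.Digraph_Component"
begin

section \<open>Reflexive lattice polytopes\<close>

definition lattice_polytope :: "'a::euclidean_space set \<Rightarrow> 'a set \<Rightarrow> bool" where
  "lattice_polytope \<Lambda> P \<longleftrightarrow> polytope P \<and> {v. v extreme_point_of P} \<subseteq> \<Lambda>"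

definition integer_lattice :: "(real ^ 'd) set" where
  "integer_lattice = {x. \<forall>i. x $ i \<in> \<int>}"

definition dual_polytope :: "'a::euclidean_space set \<Rightarrow> 'a set" where
  "dual_polytope P = {x. \<forall>y\<in>P. x \<bullet> y \<le> 1}"

text \<open>Full-dimensionality is implied by the nonempty interior.\<close>

definition standard_reflexive :: "(real ^ 'd) set \<Rightarrow> bool" where
  "standard_reflexive P \<longleftrightarrow>
     lattice_polytope integer_lattice P \<and> 0 \<in> interior P \<and>
     lattice_polytope integer_lattice (dual_polytope P)"

text \<open>
  An affine isomorphism between the affine spans of the two lattices is represented by
  an affine map \<open>x \<mapsto> f x + c\<close> on the whole ambient space, of which only the restriction
  to the span matters; every affine map on the span has such an extension.
\<close>

definition unimodularly_equivalent ::
    "'a::euclidean_space set \<Rightarrow> 'a set \<Rightarrow> 'b::euclidean_space set \<Rightarrow> 'b set \<Rightarrow> bool" where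
  "unimodularly_equivalent \<Lambda> P \<Gamma> Q \<longleftrightarrow>
     (\<exists>f c. linear f \<and>
        bij_betw (\<lambda>x. f x + c) (affine hull \<Lambda>) (affine hull \<Gamma>) \<and>
        (\<lambda>x. f x + c) ` \<Lambda> = \<Gamma> \<and>
        (\<lambda>x. f x + c) ` P = Q)"

text \<open>
  The type argument supplies the model space \<open>real ^ 'd\<close>. Unimodular equivalence
  forces \<open>CARD('d)\<close> to be the rank of \<open>\<Lambda>\<close>, so \<open>'d\<close> has to be taken of that size.
\<close>

definition reflexive_polytope ::
    "'d::finite itself \<Rightarrow> 'a::euclidean_space set \<Rightarrow> 'a set \<Rightarrow> bool" where
  "reflexive_polytope d \<Lambda> P \<longleftrightarrow>
     lattice_polytope \<Lambda> P \<and>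
     (\<exists>Q :: (real ^ 'd) set.
        standard_reflexive Q \<and> unimodularly_equivalent \<Lambda> P integer_lattice Q)"


section \<open>The Laplacian polytope of a digraph\<close>

definition adjacency_matrix :: "('n::finite, 'e) pre_digraph \<Rightarrow> real ^ 'n ^ 'n" where
  "adjacency_matrix D = (\<chi> i j. real (card {e \<in> arcs D. tail D e = i \<and> head D e = j}))"

definition outdegree_matrix :: "('n::finite, 'e) pre_digraph \<Rightarrow> real ^ 'n ^ 'n" where
  "outdegree_matrix D = (\<chi> i j. if i = j then real (out_degree D i) else 0)"

definition laplacian :: "('n::finite, 'e) pre_digraph \<Rightarrow> real ^ 'n ^ 'n" where
  "laplacian D = outdegree_matrix D - adjacency_matrix D"

definition laplacian_polytope :: "('n::finite, 'e) pre_digraph \<Rightarrow> (real ^ 'n) set" where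
  "laplacian_polytope D = convex hull (rows (laplacian D))"

definition zero_sum_lattice :: "(real ^ 'n) set" where
  "zero_sum_lattice = {x. (\<Sum>i\<in>UNIV. x $ i) = 0} \<inter> integer_lattice"


section \<open>Spanning converging trees\<close>

definition converging_tree :: "('a, 'e) pre_digraph \<Rightarrow> 'a \<Rightarrow> bool" where
  "converging_tree T r \<longleftrightarrow>
     Digraph_Component.connected T \<and> r \<in> verts T \<and> out_degree T r = 0 \<and>
     (\<forall>v \<in> verts T - {r}. out_degree T v = 1)"

text \<open>
  A subgraph shares the tail and head functions of the whole graph and is determined
  by its vertices and arcs; parallel arcs therefore give different trees.
\<close>

definition tree_count :: "('a, 'e) pre_digraph \<Rightarrow> 'a \<Rightarrow> nat" where
  "tree_count D i = card {T. spanning T D \<and> converging_tree T i}"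

definition total_tree_count :: "('a, 'e) pre_digraph \<Rightarrow> nat" where
  "total_tree_count D = (\<Sum>i\<in>verts D. tree_count D i)"

end

theory Submission
  imports Defs
begin

text \<open>
  Write \<open>L\<close> for the Laplacian, \<open>C\<close> for the sum of the tree counts \<open>c\<^sub>i\<close>. Expanding the determinant
  of \<open>L\<close> with row \<open>r\<close> replaced by a unit vector over the choices of one outgoing arc per vertex gives
  \<open>c\<^sub>r\<close> (matrix tree theorem). By Cramer's rule \<open>c\<close> lies in the left kernel of \<open>L\<close>, and, the \<open>c\<^sub>i\<close>
  being coprime, \<open>L y = x\<close> has an integer solution for every integer \<open>x\<close> orthogonal to \<open>c\<close>.
  Hence the rows of \<open>L\<close> form a simplex with weights \<open>c\<close> at the origin, whose dual has the vertices
  \<open>u\<^sub>k\<close> with \<open>L u\<^sub>k = 1 - (C / c\<^sub>k) e\<^sub>k\<close>, and these are integral iff \<open>c\<^sub>k\<close> divides \<open>C\<close>. A unimodular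
  equivalence to a standard reflexive polytope must fix the origin, because a reflexive polytope has
  no other interior lattice point.
\<close>

section \<open>Determinants and the matrix tree theorem\<close>

lemma det_Ints:
  fixes A :: "'a::comm_ring_1 ^ 'n ^ 'n"
  assumes "\<And>i j. A $ i $ j \<in> \<int>"
  shows "det A \<in> \<int>"
  unfolding det_def by (intro Ints_sum Ints_mult Ints_prod) (auto simp: assms)

text \<open>Multilinearity is applied to one row of \<open>T\<close> after another. The functions in
  \<open>Pi\<^sub>E T S\<close> record the chosen summands; their fixed value outside
  \<open>T\<close> makes each combination of choices occur exactly once.\<close>

lemma det_linear_rows_sum_PiE:
  fixes a :: "'n::finite \<Rightarrow> 'b \<Rightarrow> 'a::comm_ring_1 ^ 'n"
  assumes "finite T" and "\<And>i. i \<in> T \<Longrightarrow> finite (S i)"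
  shows "det (\<chi> i. if i \<in> T then sum (a i) (S i) else c i) =
    (\<Sum>f\<in>Pi\<^sub>E T S. det (\<chi> i. if i \<in> T then a i (f i) else c i))"
  using assms
proof (induction T arbitrary: c rule: finite_induct)
  case empty
  then show ?case by simp
next
  case (insert t T)
  have fin: "finite (Pi\<^sub>E T S)" "finite (S t)"
    using insert by (auto intro: finite_PiE)
  have "(\<chi> i. if i \<in> insert t T then sum (a i) (S i) else c i) =
      (\<chi> i. if i \<in> T then sum (a i) (S i) else if i = t then sum (a t) (S t) else c i)"
    using insert.hyps by (auto simp: vec_eq_iff)
  then have "det (\<chi> i. if i \<in> insert t T then sum (a i) (S i) else c i) =
      (\<Sum>f\<in>Pi\<^sub>E T S. det (\<chi> i. if i \<in> T then a i (f i) else if i = t then sum (a t) (S t) else c i))"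
    using insert by simp
  also have "\<dots> = (\<Sum>f\<in>Pi\<^sub>E T S. \<Sum>e\<in>S t. det (\<chi> i. if i = t then a t e else if i \<in> T then a i (f i) else c i))"
  proof (rule sum.cong[OF refl])
    fix f
    have "(\<chi> i. if i \<in> T then a i (f i) else if i = t then sum (a t) (S t) else c i) =
       (\<chi> i. if i = t then sum (a t) (S t) else if i \<in> T then a i (f i) else c i)"
      using insert.hyps by (auto simp: vec_eq_iff)
    then show "det (\<chi> i. if i \<in> T then a i (f i) else if i = t then sum (a t) (S t) else c i) =
       (\<Sum>e\<in>S t. det (\<chi> i. if i = t then a t e else if i \<in> T then a i (f i) else c i))"
      using det_linear_row_sum[OF fin(2), of t "\<lambda>_. a t" "\<lambda>i. if i \<in> T then a i (f i) else c i"] by simp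
  qed
  also have "\<dots> = (\<Sum>(e, f)\<in>S t \<times> Pi\<^sub>E T S.
      det (\<chi> i. if i = t then a t e else if i \<in> T then a i (f i) else c i))"
    by (subst sum.swap) (simp add: sum.cartesian_product)
  also have "\<dots> = (\<Sum>(e, f)\<in>S t \<times> Pi\<^sub>E T S.
      det (\<chi> i. if i \<in> insert t T then a i ((f(t := e)) i) else c i))"
    using insert.hyps
    by (intro sum.cong refl) (auto intro!: arg_cong[where f = det] simp: vec_eq_iff)
  also have "\<dots> = (\<Sum>f\<in>Pi\<^sub>E (insert t T) S. det (\<chi> i. if i \<in> insert t T then a i (f i) else c i))"
    unfolding PiE_insert_eq
    using inj_combinator[OF insert.hyps(2), of S]
    by (subst sum.reindex) (simp_all add: case_prod_unfold)
  finally show ?case .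
qed

lemma det_eq_0_if_kernel:
  fixes A :: "real ^ 'n ^ 'n"
  assumes "A *v x = 0" "x \<noteq> 0"
  shows "det A = 0"
  using assms invertible_det_nz[of A] matrix_left_invertible_ker[of A]
  unfolding invertible_left_inverse by blast

text \<open>If every vertex leads to \<open>r\<close>, only the identity survives in the Leibniz
  expansion. Otherwise the indicator of the vertices that do not lead to \<open>r\<close> is a
  nonzero kernel vector.\<close>

lemma det_functional_graph:
  fixes g :: "'n::finite \<Rightarrow> 'n" and r :: 'n
  defines "R \<equiv> {(i, g i) | i. i \<noteq> r}"
  shows "det (\<chi> i. if i = r then axis r 1 else axis i 1 - axis (g i) 1 :: real ^ 'n ^ 'n) =
    (if \<forall>i. (i, r) \<in> R\<^sup>* then 1 else 0)" (is "det ?M = _")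
proof (cases "\<forall>i. (i, r) \<in> R\<^sup>*")
  case True
  have no_fix: "g i \<noteq> i" if "i \<noteq> r" for i
  proof
    assume "g i = i"
    have "y = i" if "(i, y) \<in> R\<^sup>*" for y
      using that by induction (auto simp: R_def \<open>g i = i\<close>)
    then show False using True that by auto
  qed
  have "(\<Prod>i\<in>UNIV. ?M $ i $ p i) = 0" if p: "p permutes UNIV" "p \<noteq> id" for p
  proof (rule ccontr)
    assume "(\<Prod>i\<in>UNIV. ?M $ i $ p i) \<noteq> 0"
    then have nz: "?M $ i $ p i \<noteq> 0" for i by (auto simp: prod_zero_iff)
    have pr: "p r = r" using nz[of r] by (auto simp: axis_def split: if_splits)
    \<comment> \<open>Row \<open>i\<close> is nonzero at most in the columns \<open>i\<close> and
      \<open>g i\<close>. Going back along a path to \<open>r\<close>, column \<open>g i\<close> is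
      already taken by row \<open>g i\<close>, so injectivity of \<open>p\<close> leaves only column
      \<open>i\<close>.\<close>
    have "p i = i" for i
    proof -
      have "(i, r) \<in> R\<^sup>*" using True by simp
      then show "p i = i"
      proof (induction rule: converse_rtrancl_induct)
        case (step i j)
        then have "j = g i" "i \<noteq> r" by (auto simp: R_def)
        then have nz': "(axis i 1 - axis j 1 :: real ^ 'n) $ p i \<noteq> 0"
          using nz[of i] by simp
        have "p i = i \<or> p i = j"
        proof (rule ccontr)
          assume "\<not> (p i = i \<or> p i = j)"
          then have "(axis i 1 - axis j 1 :: real ^ 'n) $ p i = 0" by (simp add: axis_def)
          with nz' show False by contradiction
        qed
        then show ?case using step.IH permutes_inj[OF p(1)] by (metis injD)
      qed (rule pr)
    qed
    then show False using p(2) by auto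
  qed
  then have "det ?M = (\<Sum>p\<in>{id}. of_int (sign p) * (\<Prod>i\<in>UNIV. ?M $ i $ p i))"
    unfolding det_def by (intro sum.mono_neutral_right) (auto simp: permutes_id)
  also have "\<dots> = 1"
    using no_fix by (auto simp: axis_def eq_commute[of _ "g _"] intro!: prod.neutral)
  finally show ?thesis using True by simp
next
  case False
  define v :: "real ^ 'n" where "v = (\<chi> i. if (i, r) \<in> R\<^sup>* then 0 else 1)"
  have "?M *v v = 0"
  proof -
    have "(?M $ i) \<bullet> v = 0" for i
    proof (cases "i = r")
      case True
      then show ?thesis by (simp add: inner_axis' v_def)
    next
      case False
      then have "(i, g i) \<in> R" by (auto simp: R_def)
      moreover have "(i, r) \<in> R\<^sup>* \<longleftrightarrow> (g i, r) \<in> R\<^sup>*"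
      proof
        assume "(i, r) \<in> R\<^sup>*"
        then show "(g i, r) \<in> R\<^sup>*"
          using False by (cases rule: converse_rtranclE) (auto simp: R_def)
      qed (use \<open>(i, g i) \<in> R\<close> in auto)
      ultimately show ?thesis using False by (simp add: inner_diff_left inner_axis' v_def)
    qed
    then show ?thesis by (simp add: vec_eq_iff matrix_vector_mul_component)
  qed
  moreover have "v \<noteq> 0" using False by (auto simp: v_def vec_eq_iff)
  ultimately have "det ?M = 0" by (rule det_eq_0_if_kernel)
  with False show ?thesis by simp
qed

section \<open>Spanning trees as choices of outgoing arcs\<close>

lemma laplacian_row:
  fixes D :: "('n::finite, 'e) pre_digraph"
  assumes "fin_digraph D"
  shows "laplacian D $ i = (\<Sum>e\<in>out_arcs D i. axis i 1 - axis (head D e) 1)"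
proof -
  have fin: "finite (out_arcs D i)"
    using fin_digraph.finite_out_arcs[OF assms] .
  have "laplacian D $ i $ j = (\<Sum>e\<in>out_arcs D i. axis i 1 - axis (head D e) 1) $ j" for j
  proof -
    have "(\<Sum>e\<in>out_arcs D i. axis i 1 - axis (head D e) (1::real)) $ j =
        (\<Sum>e\<in>out_arcs D i. (if i = j then 1 else 0) - (if head D e = j then 1 else 0))"
      by (simp add: axis_def eq_commute)
    also have "\<dots> = (if i = j then real (out_degree D i) else 0)
        - real (card {e \<in> out_arcs D i. head D e = j})"
      using fin by (simp add: sum_subtractf out_degree_def sum.If_cases Int_def)
    also have "{e \<in> out_arcs D i. head D e = j} = {e \<in> arcs D. tail D e = i \<and> head D e = j}"
      by (auto simp: out_arcs_def)
    finally show ?thesis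
      by (simp add: laplacian_def outdegree_matrix_def adjacency_matrix_def)
  qed
  then show ?thesis by (simp add: vec_eq_iff)
qed

lemma laplacian_mult_component:
  fixes D :: "('n::finite, 'e) pre_digraph"
  assumes "fin_digraph D"
  shows "(laplacian D *v y) $ i = (\<Sum>e\<in>out_arcs D i. y $ i - y $ head D e)"
  unfolding matrix_vector_mul_component laplacian_row[OF assms]
  by (simp add: inner_sum_left inner_diff_left inner_axis')

text \<open>A tree with root \<open>r\<close> consists of the arcs selected by \<open>f\<close>.
  With one selected arc out of each vertex but \<open>r\<close>, undirected connectedness amounts to
  a directed path from every vertex to \<open>r\<close>.\<close>

lemma tree_count_eq_card_choices:
  fixes D :: "('n::finite, 'e) pre_digraph"
  assumes "fin_digraph D" and verts: "verts D = UNIV"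
  shows "tree_count D r = card {f \<in> Pi\<^sub>E (- {r}) (out_arcs D).
    \<forall>i. (i, r) \<in> {(j, head D (f j)) | j. j \<noteq> r}\<^sup>*}" (is "_ = card ?F")
proof -
  interpret fin_digraph D by fact
  define G where "G f = D\<lparr>arcs := f ` (- {r})\<rparr>" for f
  have tail_f: "tail D (f j) = j" "f j \<in> arcs D" if "f \<in> ?F" "j \<noteq> r" for f j
    using that by (auto simp: out_arcs_def Pi_iff PiE_iff)
  have inj: "inj_on G ?F"
  proof (rule inj_onI)
    fix f f' assume f: "f \<in> ?F" "f' \<in> ?F" "G f = G f'"
    have eq: "f ` (- {r}) = f' ` (- {r})"
      using arg_cong[OF f(3), of arcs] by (simp add: G_def)
    have "f j = f' j" if "j \<noteq> r" for j
    proof -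
      have "f j \<in> f' ` (- {r})" using eq that by blast
      then obtain k where "k \<noteq> r" "f j = f' k" by auto
      then show ?thesis using tail_f(1)[OF f(1) that] tail_f(1)[OF f(2), of k] by simp
    qed
    moreover have "f r = undefined" "f' r = undefined" using f by (auto simp: PiE_iff extensional_def)
    ultimately show "f = f'" by (metis ext)
  qed
  have "G f \<in> {T. spanning T D \<and> converging_tree T r}" if f: "f \<in> ?F" for f
  proof -
    let ?S = "{(j, head D (f j)) | j. j \<noteq> r}"
    have sel: "verts (G f) = UNIV" "tail (G f) = tail D" "head (G f) = head D" "arcs (G f) = f ` (- {r})"
      by (auto simp: G_def verts)
    have out: "out_arcs (G f) i = (if i = r then {} else {f i})" for i
    proof -
      have "out_arcs (G f) i = f ` {j. j \<noteq> r \<and> j = i}"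
        using tail_f(1)[OF f] by (auto simp: out_arcs_def sel image_iff)
      then show ?thesis by auto
    qed
    have wf: "wf_digraph (G f)" by standard (auto simp: sel)
    interpret T: wf_digraph "G f" by fact
    interpret S: pair_wf_digraph "mk_symmetric (G f)" by auto
    have dom: "?S \<subseteq> parcs (mk_symmetric (G f))"
      using tail_f[OF f] by (fastforce simp: parcs_mk_symmetric sel)
    have "i \<rightarrow>\<^sup>*\<^bsub>mk_symmetric (G f)\<^esub> r" for i
    proof -
      have "(i, r) \<in> ?S\<^sup>*" using f by auto
      then show ?thesis
      proof (induction rule: converse_rtrancl_induct)
        case (step y z)
        then have "y \<rightarrow>\<^bsub>mk_symmetric (G f)\<^esub> z" using dom by auto
        then show ?case using step.IH
          unfolding reachable_def by (rule converse_rtrancl_on_into_rtrancl_on) (simp add: sel)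
      qed (simp add: sel)
    qed
    moreover have "symmetric (mk_symmetric (G f))"
      by (auto simp: symmetric_def parcs_mk_symmetric sym_def)
    ultimately have "Digraph_Component.connected (G f)"
      unfolding connected_def strongly_connected_def
      by (auto simp: sel intro: S.reachable_trans dest: symmetric_reachable)
    then have "converging_tree (G f) r"
      by (auto simp: converging_tree_def sel out_degree_def out)
    moreover have "spanning (G f) D"
      using wf tail_f[OF f] by (auto simp: spanning_def subgraph_def compatible_def sel verts wf_digraph)
    ultimately show ?thesis by simp
  qed
  moreover have "T \<in> G ` ?F" if T: "spanning T D" "converging_tree T r" for T
  proof -
    have sel: "verts T = UNIV" "tail T = tail D" "head T = head D" "arcs T \<subseteq> arcs D" "wf_digraph T"
      using T(1) by (auto simp: spanning_def subgraph_def compatible_def verts)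
    interpret T: wf_digraph T by fact
    have "\<exists>e. out_arcs T j = {e}" if "j \<noteq> r" for j
      using T(2) that by (auto simp: converging_tree_def sel out_degree_def card_1_singleton_iff)
    then obtain f0 where f0: "\<And>j. j \<noteq> r \<Longrightarrow> out_arcs T j = {f0 j}" by metis
    define f where "f = restrict f0 (- {r})"
    have f: "out_arcs T j = {f j}" if "j \<noteq> r" for j using f0 that by (auto simp: f_def)
    have "finite (arcs T)" using sel(4) finite_arcs finite_subset by blast
    then have "finite (out_arcs T r)" by (auto simp: out_arcs_def)
    then have "out_arcs T r = {}"
      using T(2) by (auto simp: converging_tree_def out_degree_def)
    have arcs: "arcs T = f ` (- {r})"
    proof (intro subset_antisym subsetI)
      fix e assume "e \<in> arcs T"
      then have e: "e \<in> out_arcs T (tail T e)" by (simp add: out_arcs_def)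
      with \<open>out_arcs T r = {}\<close> have "tail T e \<noteq> r" by auto
      then show "e \<in> f ` (- {r})" using f[of "tail T e"] e by blast
    next
      fix e assume "e \<in> f ` (- {r})"
      then obtain j where "j \<noteq> r" "e = f j" by auto
      then have "e \<in> out_arcs T j" using f by simp
      then show "e \<in> arcs T" by (simp add: out_arcs_def)
    qed
    then have "T = G f" using sel by (auto simp: G_def verts)
    have tl: "tail D (f j) = j" "f j \<in> arcs T" if "j \<noteq> r" for j
      using f[OF that] by (auto simp: out_arcs_def sel)
    let ?S = "{(j, head D (f j)) | j. j \<noteq> r}"
    \<comment> \<open>Reachability of \<open>r\<close> spreads along an undirected path that starts
      at \<open>r\<close>. When an arc is followed forwards, the directed path from \<open>y\<close>
      to \<open>r\<close> must begin with the only arc out of \<open>y\<close>; when followed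
      backwards, the arc extends that path.\<close>
    have "(i, r) \<in> ?S\<^sup>*" for i
    proof -
      have "r \<rightarrow>\<^sup>*\<^bsub>mk_symmetric T\<^esub> i"
        using T(2) by (auto simp: converging_tree_def connected_def strongly_connected_def sel)
      then have "(r, i) \<in> (parcs (mk_symmetric T))\<^sup>*" using reachable_rtranclI by fastforce
      then show ?thesis
      proof (induction rule: rtrancl_induct)
        case (step y z)
        then obtain j where j: "j \<noteq> r" "(y, z) = (j, head D (f j)) \<or> (y, z) = (head D (f j), j)"
          by (auto simp: parcs_mk_symmetric arcs sel tl)
        from j(2) show ?case
        proof
          assume yz: "(y, z) = (j, head D (f j))"
          show ?thesis using step.IH
            by (cases rule: converse_rtranclE) (use yz j(1) in auto)
        next
          assume "(y, z) = (head D (f j), j)"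
          then have "(z, y) \<in> ?S" using j(1) by auto
          then show ?thesis using step.IH by (rule converse_rtrancl_into_rtrancl)
        qed
      qed simp
    qed
    moreover have "f \<in> Pi\<^sub>E (- {r}) (out_arcs D)"
      using f sel by (fastforce simp: f_def out_arcs_def)
    ultimately show ?thesis using \<open>T = G f\<close> by auto
  qed
  ultimately have "G ` ?F = {T. spanning T D \<and> converging_tree T r}" by auto
  then show ?thesis unfolding tree_count_def using card_image[OF inj] by simp
qed

text \<open>The unit row gives the determinant of the minor without row and column \<open>r\<close>,
  while the matrix stays indexed by \<open>'n\<close>.\<close>

definition rooted_laplacian :: "('n::finite, 'e) pre_digraph \<Rightarrow> 'n \<Rightarrow> real ^ 'n ^ 'n" where
  "rooted_laplacian D r = (\<chi> i. if i = r then axis r 1 else laplacian D $ i)"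

theorem matrix_tree:
  fixes D :: "('n::finite, 'e) pre_digraph"
  assumes D: "fin_digraph D" "verts D = UNIV"
  shows "det (rooted_laplacian D r) = real (tree_count D r)"
proof -
  interpret fin_digraph D by fact
  let ?P = "Pi\<^sub>E (- {r}) (out_arcs D)"
  let ?reach = "\<lambda>f. \<forall>i. (i, r) \<in> {(j, head D (f j)) | j. j \<noteq> r}\<^sup>*"
  have "finite ?P" by (intro finite_PiE) auto
  have "rooted_laplacian D r = (\<chi> i. if i \<in> - {r}
      then (\<Sum>e\<in>out_arcs D i. axis i 1 - axis (head D e) 1) else axis r 1)"
    by (auto simp: rooted_laplacian_def laplacian_row[OF D(1)] vec_eq_iff)
  then have "det (rooted_laplacian D r) = (\<Sum>f\<in>?P. det (\<chi> i. if i \<in> - {r}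
      then axis i 1 - axis (head D (f i)) 1 else axis r 1))"
    by (simp only: det_linear_rows_sum_PiE[OF finite finite_out_arcs])
  also have "\<dots> = (\<Sum>f\<in>?P. if ?reach f then 1 else 0)"
  proof (rule sum.cong[OF refl])
    fix f
    have "(\<chi> i. if i \<in> - {r} then axis i 1 - axis (head D (f i)) 1 else axis r 1) =
      (\<chi> i. if i = r then axis r 1 else axis i 1 - axis (head D (f i)) 1 :: real ^ 'n ^ 'n)"
      by (auto simp: vec_eq_iff)
    then show "det (\<chi> i. if i \<in> - {r} then axis i 1 - axis (head D (f i)) 1 else axis r 1 :: real ^ 'n ^ 'n) =
      (if ?reach f then 1 else 0)"
      using det_functional_graph[of r "\<lambda>i. head D (f i)"] by simp
  qed
  also have "\<dots> = real (tree_count D r)"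
    using \<open>finite ?P\<close> by (simp add: sum.If_cases tree_count_eq_card_choices[OF D] Int_def)
  finally show ?thesis .
qed

section \<open>The cokernel of the Laplacian\<close>

lemma laplacian_mult_const:
  fixes D :: "('n::finite, 'e) pre_digraph"
  assumes "fin_digraph D"
  shows "laplacian D *v (\<chi> i. t) = 0"
  by (simp add: vec_eq_iff laplacian_mult_component[OF assms])

text \<open>With row \<open>s\<close> replaced by a difference of two unit vectors, all row sums are
  zero and the determinant vanishes. By linearity in row \<open>s\<close>, every column
  \<open>t\<close> yields the same value as column \<open>s\<close>.\<close>

lemma det_laplacian_axis_row:
  fixes D :: "('n::finite, 'e) pre_digraph"
  assumes D: "fin_digraph D" "verts D = UNIV"
  shows "det (\<chi> i. if i = s then axis t 1 else laplacian D $ i) = real (tree_count D s)"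
proof -
  let ?M = "\<lambda>v. ((\<chi> i. if i = s then v else laplacian D $ i) :: real ^ 'n ^ 'n)"
  have "?M (axis s 1 - axis t 1) *v (\<chi> i. 1) = 0"
    using laplacian_mult_const[OF D(1), of 1]
    by (auto simp: vec_eq_iff matrix_vector_mul_component inner_diff_left inner_axis')
  moreover have "((\<chi> i. 1) :: real ^ 'n) \<noteq> 0" by (simp add: vec_eq_iff)
  ultimately have "det (?M (axis s 1 - axis t 1)) = 0" by (rule det_eq_0_if_kernel)
  then have "det (?M (axis t 1)) = det (?M (axis s 1))"
    using det_row_add[of s "\<lambda>_. axis s 1 - axis t 1 :: real ^ 'n" "\<lambda>_. axis t 1" "\<lambda>i. laplacian D $ i"]
    by (simp cong: if_cong)
  also have "\<dots> = real (tree_count D s)"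
    using matrix_tree[OF D, of s] by (auto simp: rooted_laplacian_def)
  finally show ?thesis .
qed

text \<open>Cramer's rule expresses row \<open>r\<close> of the Laplacian in terms of the rows of the rooted Laplacian;
  swapping two rows turns the numerators into tree counts.\<close>

theorem tree_count_left_kernel:
  fixes D :: "('n::finite, 'e) pre_digraph"
  assumes D: "fin_digraph D" "verts D = UNIV" and r: "tree_count D r \<noteq> 0"
  shows "(\<Sum>i\<in>UNIV. real (tree_count D i) *\<^sub>R laplacian D $ i) = 0"
proof -
  let ?c = "\<lambda>i. real (tree_count D i)"
  let ?L = "laplacian D"
  define M where "M = rooted_laplacian D r"
  have row_M: "row i M = (if i = r then axis r 1 else ?L $ i)" for i
    by (simp add: M_def rooted_laplacian_def row_def vec_eq_iff)
  have det_M: "det M = ?c r" using matrix_tree[OF D] by (simp add: M_def)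
  then obtain y where "transpose M *v y = ?L $ r"
    using cramer[of "transpose M"] r by auto
  then have y: "(\<Sum>i\<in>UNIV. y $ i *s row i M) = ?L $ r"
    by (simp add: matrix_mult_sum)
  have y_det: "det (\<chi> i. if i = k then ?L $ r else row i M) = y $ k * ?c r" for k
    using cramer_lemma_transpose[of k y M] unfolding y det_M .
  \<comment> \<open>Coordinate \<open>r\<close> of the Cramer solution is
    \<open>det ?L / ?c r\<close>, which vanishes because constant vectors lie in the kernel of
    \<open>?L\<close>.\<close>
  have "(\<chi> i. if i = r then ?L $ r else row i M) = ?L"
    by (simp add: row_M vec_eq_iff)
  moreover have "det ?L = 0"
    by (rule det_eq_0_if_kernel[OF laplacian_mult_const[OF D(1), of 1]]) (simp add: vec_eq_iff)
  ultimately have y_r: "y $ r = 0" using y_det[of r] r by simp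
  have y_s: "y $ s * ?c r = - ?c s" if "s \<noteq> r" for s
  proof -
    let ?N = "((\<chi> i. if i = s then ?L $ r else row i M) :: real ^ 'n ^ 'n)"
    have "(\<chi> i. ?N $ Transposition.transpose r s i) = (\<chi> i. if i = s then axis r 1 else ?L $ i)"
      using that by (simp add: vec_eq_iff row_M Transposition.transpose_def)
    moreover have "det (\<chi> i. ?N $ Transposition.transpose r s i) = - det ?N"
      using that by (subst det_permute_rows) (simp_all add: permutes_swap_id sign_swap_id)
    ultimately show ?thesis
      using det_laplacian_axis_row[OF D, of s r] y_det[of s] by simp
  qed
  have "?c r *\<^sub>R ?L $ r = (\<Sum>i\<in>UNIV. (y $ i * ?c r) *\<^sub>R row i M)"
    unfolding y[symmetric]
    by (simp add: scaleR_sum_right scalar_mult_eq_scaleR mult.commute)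
  also have "\<dots> = (\<Sum>i\<in>UNIV - {r}. (y $ i * ?c r) *\<^sub>R row i M)"
    using y_r by (simp add: sum.remove[of _ r])
  also have "\<dots> = - (\<Sum>i\<in>UNIV - {r}. ?c i *\<^sub>R ?L $ i)"
    unfolding sum_negf[symmetric] by (rule sum.cong) (auto simp: y_s row_M)
  finally show ?thesis by (simp add: sum.remove[of UNIV r])
qed

text \<open>A zero tree count propagates backwards along arcs: in column \<open>j\<close> of the
  left kernel relation all terms then have the same sign, so each of them vanishes. Strong
  connectedness would carry the zero to \<open>r\<close>.\<close>

lemma tree_count_pos:
  fixes D :: "('n::finite, 'e) pre_digraph"
  assumes D: "fin_digraph D" "verts D = UNIV" and sc: "strongly_connected D"
    and r: "tree_count D r \<noteq> 0"
  shows "tree_count D v > 0"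
proof (rule ccontr)
  interpret fin_digraph D by fact
  assume "\<not> tree_count D v > 0"
  then have "tree_count D v = 0" by simp
  have step: "tree_count D i = 0" if ij: "i \<rightarrow>\<^bsub>D\<^esub> j" and "tree_count D j = 0" for i j
  proof -
    let ?a = "\<lambda>i. {e \<in> arcs D. tail D e = i \<and> head D e = j}"
    have "0 = (\<Sum>k\<in>UNIV. real (tree_count D k) *\<^sub>R laplacian D $ k) $ j"
      using tree_count_left_kernel[OF D r] by simp
    also have "\<dots> = (\<Sum>k\<in>UNIV. real (tree_count D k) * laplacian D $ k $ j)"
      by simp
    \<comment> \<open>The outdegree enters only for \<open>k = j\<close>, where the tree count is
      zero.\<close>
    also have "\<dots> = (\<Sum>k\<in>UNIV. - (real (tree_count D k) * real (card (?a k))))"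
    proof (rule sum.cong[OF refl])
      fix k
      show "real (tree_count D k) * laplacian D $ k $ j = - (real (tree_count D k) * real (card (?a k)))"
        using that(2) by (cases "k = j")
          (simp_all add: laplacian_def outdegree_matrix_def adjacency_matrix_def)
    qed
    finally have "(\<Sum>k\<in>UNIV. real (tree_count D k) * real (card (?a k))) = 0"
      by (simp add: sum_negf)
    then have zero: "real (tree_count D i) * real (card (?a i)) = 0"
      using sum_nonneg_eq_0_iff[of UNIV "\<lambda>k. real (tree_count D k) * real (card (?a k))"] by simp
    obtain e where "e \<in> ?a i" using ij by (auto simp: arcs_ends_conv)
    moreover have "finite (?a i)" by simp
    ultimately have "card (?a i) \<noteq> 0" using card_eq_0_iff[of "?a i"] by blast
    with zero show ?thesis by simp
  qed
  have "r \<rightarrow>\<^sup>*\<^bsub>D\<^esub> v" using sc D(2) by (auto simp: strongly_connected_def)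
  then have "tree_count D r = 0"
    by (induction rule: converse_reachable_induct) (use step \<open>tree_count D v = 0\<close> in auto)
  with r show False by simp
qed

text \<open>Subtracting the constant \<open>y $ r\<close> produces a kernel vector that vanishes at
  \<open>r\<close>. It is annihilated by the rooted Laplacian as well, whose determinant is
  nonzero.\<close>

lemma laplacian_kernel:
  fixes D :: "('n::finite, 'e) pre_digraph"
  assumes D: "fin_digraph D" "verts D = UNIV" and r: "tree_count D r \<noteq> 0"
    and y: "laplacian D *v y = 0"
  shows "y $ i = y $ r"
proof (rule ccontr)
  assume "y $ i \<noteq> y $ r"
  define z where "z = y - (\<chi> i. y $ r)"
  have "laplacian D *v z = 0"
    using y laplacian_mult_const[OF D(1)] by (simp add: z_def matrix_vector_mult_diff_distrib)
  then have "laplacian D $ k \<bullet> z = 0" for k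
    by (metis matrix_vector_mul_component zero_index)
  then have "rooted_laplacian D r *v z = 0"
    by (simp add: vec_eq_iff matrix_vector_mul_component rooted_laplacian_def inner_axis' z_def)
  moreover have "z \<noteq> 0" using \<open>y $ i \<noteq> y $ r\<close> by (auto simp: z_def vec_eq_iff)
  ultimately have "det (rooted_laplacian D r) = 0" by (rule det_eq_0_if_kernel)
  then show False using matrix_tree[OF D, of r] r by simp
qed

section \<open>Integer solutions of Laplacian equations\<close>

lemma Gcd_image_eq_combination:
  fixes c :: "'a \<Rightarrow> nat"
  assumes "finite A"
  shows "\<exists>k. (\<Sum>a\<in>A. k a * int (c a)) = int (Gcd (c ` A))"
  using assms
proof (induction A rule: finite_induct)
  case (insert b A)
  then obtain k where k: "(\<Sum>a\<in>A. k a * int (c a)) = int (Gcd (c ` A))" by blast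
  obtain u v where uv: "u * int (c b) + v * int (Gcd (c ` A)) = gcd (int (c b)) (int (Gcd (c ` A)))"
    using bezout_int by blast
  have "(\<Sum>a\<in>A. (if a = b then u else v * k a) * int (c a)) = v * (\<Sum>a\<in>A. k a * int (c a))"
    using insert.hyps unfolding sum_distrib_left by (intro sum.cong) auto
  then have "(\<Sum>a\<in>insert b A. (if a = b then u else v * k a) * int (c a)) = int (Gcd (c ` insert b A))"
    using insert.hyps uv k by simp
  then show ?case by (intro exI[of _ "\<lambda>a. if a = b then u else v * k a"])
qed simp

lemma integer_lattice_0 [simp]: "0 \<in> integer_lattice"
  and integer_lattice_diff: "x \<in> integer_lattice \<Longrightarrow> y \<in> integer_lattice \<Longrightarrow> x - y \<in> integer_lattice"
  and integer_lattice_scaleR: "k \<in> \<int> \<Longrightarrow> x \<in> integer_lattice \<Longrightarrow> k *\<^sub>R x \<in> integer_lattice"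
  and integer_lattice_inner: "x \<in> integer_lattice \<Longrightarrow> y \<in> integer_lattice \<Longrightarrow> x \<bullet> y \<in> \<int>"
  by (auto simp: integer_lattice_def inner_vec_def intro!: Ints_sum Ints_mult Ints_add Ints_diff)

lemma integer_lattice_sum:
  assumes "\<And>a. a \<in> A \<Longrightarrow> x a \<in> integer_lattice"
  shows "sum x A \<in> integer_lattice"
  using assms by (auto simp: integer_lattice_def intro!: Ints_sum)

lemma integer_lattice_axis [simp]: "axis i 1 \<in> integer_lattice"
  by (auto simp: integer_lattice_def axis_def)

lemma laplacian_row_integer:
  fixes D :: "('n::finite, 'e) pre_digraph"
  assumes "fin_digraph D"
  shows "laplacian D $ i \<in> integer_lattice"
  unfolding laplacian_row[OF assms] by (intro integer_lattice_sum integer_lattice_diff) auto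

text \<open>The rooted Laplacian has determinant \<open>tree_count D r\<close>, so Cramer's rule
  solves the system up to this factor with integer determinants as coordinates.\<close>

lemma laplacian_integer_solution_multiple:
  fixes D :: "('n::finite, 'e) pre_digraph"
  assumes D: "fin_digraph D" "verts D = UNIV" and r: "tree_count D r \<noteq> 0"
    and x: "x \<in> integer_lattice" "(\<Sum>i\<in>UNIV. real (tree_count D i) * x $ i) = 0"
  obtains y where "y \<in> integer_lattice" "laplacian D *v y = real (tree_count D r) *\<^sub>R x"
proof -
  let ?c = "\<lambda>i. real (tree_count D i)"
  let ?L = "laplacian D"
  define M where "M = rooted_laplacian D r"
  \<comment> \<open>The value 0 at \<open>r\<close> normalizes the solution to
    \<open>y $ r = 0\<close>.\<close>
  define b where "b = (\<chi> i. if i = r then 0 else x $ i)"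
  have det_M: "det M = ?c r" using matrix_tree[OF D] by (simp add: M_def)
  define y where "y = (\<chi> k. det (\<chi> i j. if j = k then b $ i else M $ i $ j))"
  have "M $ i $ j \<in> \<int>" for i j
    using laplacian_row_integer[OF D(1)] integer_lattice_axis[of r]
    by (auto simp: M_def rooted_laplacian_def integer_lattice_def)
  then have "y \<in> integer_lattice"
    using x(1) by (auto simp: integer_lattice_def y_def b_def intro!: det_Ints)
  moreover have My: "M *v y = ?c r *\<^sub>R b"
  proof -
    have "M *v ((1 / ?c r) *\<^sub>R y) = b"
      using r det_M by (subst cramer) (simp_all add: y_def vec_eq_iff)
    then have "(1 / ?c r) *\<^sub>R (M *v y) = b" by (simp add: matrix_vector_mult_scaleR)
    then have "?c r *\<^sub>R (1 / ?c r) *\<^sub>R (M *v y) = ?c r *\<^sub>R b" by simp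
    then show ?thesis using r by simp
  qed
  have Ly: "(?L *v y) $ i = ?c r * x $ i" if "i \<noteq> r" for i
  proof -
    have "(?L *v y) $ i = (M *v y) $ i"
      using that by (simp add: matrix_vector_mul_component M_def rooted_laplacian_def)
    then show ?thesis using that by (simp add: My b_def)
  qed
  \<comment> \<open>Row \<open>r\<close> of the Laplacian is absent from \<open>M\<close>. Its
    equation follows from the others, since both sides are orthogonal to the tree counts and
    \<open>?c r\<close> is nonzero.\<close>
  moreover have "(?L *v y) $ r = ?c r * x $ r"
  proof -
    have "(\<Sum>i\<in>UNIV. ?c i * (?L *v y) $ i) = (\<Sum>i\<in>UNIV. ?c i *\<^sub>R ?L $ i) \<bullet> y"
      by (simp add: inner_sum_left matrix_vector_mul_component)
    also have "\<dots> = 0" by (simp add: tree_count_left_kernel[OF D r])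
    finally have "?c r * (?L *v y) $ r + (\<Sum>i\<in>UNIV - {r}. ?c r * (?c i * x $ i)) = 0"
      by (simp add: sum.remove[of UNIV r] Ly mult_ac)
    moreover have "?c r * x $ r + (\<Sum>i\<in>UNIV - {r}. ?c i * x $ i) = 0"
      using x(2) by (simp add: sum.remove[of UNIV r])
    ultimately have "?c r * ((?L *v y) $ r - ?c r * x $ r) = 0"
      unfolding sum_distrib_left[symmetric] by algebra
    then show ?thesis using r by simp
  qed
  ultimately have "?L *v y = ?c r *\<^sub>R x" unfolding vec_eq_iff by (metis vector_scaleR_component real_scaleR_def)
  with \<open>y \<in> integer_lattice\<close> show thesis by (rule that)
qed

text \<open>Every tree count annihilates the cokernel, hence so does their gcd.\<close>

lemma laplacian_integer_solution:
  fixes D :: "('n::finite, 'e) pre_digraph"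
  assumes D: "fin_digraph D" "verts D = UNIV" and pos: "\<And>i. tree_count D i \<noteq> 0"
    and gcd: "Gcd (range (tree_count D)) = 1"
    and x: "x \<in> integer_lattice" "(\<Sum>i\<in>UNIV. real (tree_count D i) * x $ i) = 0"
  obtains y where "y \<in> integer_lattice" "laplacian D *v y = x"
proof -
  obtain k where "(\<Sum>r\<in>UNIV. k r * int (tree_count D r)) = 1"
    using Gcd_image_eq_combination[of UNIV "tree_count D"] gcd by auto
  then have k: "(\<Sum>r\<in>UNIV. of_int (k r) * real (tree_count D r)) = 1"
    by (metis (mono_tags, lifting) of_int_1 of_int_mult of_int_of_nat_eq of_int_sum sum.cong)
  have "\<forall>r. \<exists>y. y \<in> integer_lattice \<and> laplacian D *v y = real (tree_count D r) *\<^sub>R x"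
    by (metis laplacian_integer_solution_multiple[OF D pos x])
  then obtain y where y: "\<And>r. y r \<in> integer_lattice"
      "\<And>r. laplacian D *v y r = real (tree_count D r) *\<^sub>R x"
    by metis
  \<comment> \<open>The Bezout coefficients combine the solutions for the multiples of
    \<open>x\<close> into one for \<open>x\<close> itself.\<close>
  define z where "z = (\<Sum>r\<in>UNIV. real_of_int (k r) *\<^sub>R y r)"
  have "z \<in> integer_lattice"
    unfolding z_def by (intro integer_lattice_sum integer_lattice_scaleR y) auto
  moreover have "laplacian D *v z = (\<Sum>r\<in>UNIV. (of_int (k r) * real (tree_count D r)) *\<^sub>R x)"
    unfolding z_def
    by (simp add: linear_sum[OF matrix_vector_mul_linear] matrix_vector_mult_scaleR y)
  then have "laplacian D *v z = x" by (simp add: k flip: scaleR_sum_left)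
  ultimately show thesis by (rule that)
qed

section \<open>Dual simplices and reflexivity\<close>

lemma mem_dual_convex_hull_iff:
  "x \<in> dual_polytope (convex hull S) \<longleftrightarrow> (\<forall>s\<in>S. x \<bullet> s \<le> 1)"
proof
  assume *: "\<forall>s\<in>S. x \<bullet> s \<le> 1"
  have "convex hull S \<subseteq> {y. x \<bullet> y \<le> 1}"
    using * by (intro hull_minimal) (auto simp: convex_halfspace_le)
  then show "x \<in> dual_polytope (convex hull S)" by (auto simp: dual_polytope_def)
qed (auto simp: dual_polytope_def hull_inc)

lemma convex_dual_polytope: "convex (dual_polytope P)"
proof -
  have "dual_polytope P = (\<Inter>y\<in>P. {x. y \<bullet> x \<le> 1})"
    by (auto simp: dual_polytope_def inner_commute)
  then show ?thesis by (auto intro!: convex_INT convex_halfspace_le)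
qed

text \<open>If \<open>B\<close> bounds the norms in \<open>P\<close>, the Cauchy-Schwarz inequality
  puts the ball of radius \<open>1 / B\<close> into the dual.\<close>

lemma zero_in_interior_dual_polytope:
  fixes P :: "'a::euclidean_space set"
  assumes "bounded P"
  shows "0 \<in> interior (dual_polytope P)"
proof -
  obtain B where B: "B > 0" "\<And>y. y \<in> P \<Longrightarrow> norm y \<le> B"
    using assms bounded_pos by blast
  have "ball 0 (1 / B) \<subseteq> dual_polytope P"
  proof
    fix x :: 'a assume "x \<in> ball 0 (1 / B)"
    then have x: "norm x \<le> 1 / B" by simp
    have "x \<bullet> y \<le> 1" if "y \<in> P" for y
    proof -
      have "x \<bullet> y \<le> norm x * norm y" by (rule norm_cauchy_schwarz)
      also have "\<dots> \<le> 1 / B * B" using x B that by (intro mult_mono) auto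
      finally show ?thesis using B by simp
    qed
    then show "x \<in> dual_polytope P" by (simp add: dual_polytope_def)
  qed
  then show ?thesis using B(1) by (meson centre_in_ball divide_pos_pos interior_maximal open_ball subsetD zero_less_one)
qed

text \<open>A dual vertex has an integral product with \<open>q\<close> that is less than 1, hence
  at most 0. The whole dual then lies in a halfspace bounded by a hyperplane through the origin,
  although it contains a ball about the origin.\<close>

lemma standard_reflexive_interior_lattice_point:
  assumes Q: "standard_reflexive Q" and q: "q \<in> interior Q" "q \<in> integer_lattice"
  shows "q = 0"
proof (rule ccontr)
  assume "q \<noteq> 0"
  let ?D = "dual_polytope Q"
  have "polytope ?D" "bounded Q" and int: "\<And>u. u extreme_point_of ?D \<Longrightarrow> u \<in> integer_lattice"
    using Q by (auto simp: standard_reflexive_def lattice_polytope_def polytope_imp_bounded)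
  have "u \<bullet> q \<le> 0" if u: "u extreme_point_of ?D" for u
  proof (cases "u = 0")
    case False
    obtain e where e: "e > 0" "ball q e \<subseteq> Q" using q(1) mem_interior by blast
    \<comment> \<open>A small move from \<open>q\<close> in direction \<open>u\<close> stays in
      \<open>Q\<close> and increases the product with \<open>u\<close>, which makes the bound at
      \<open>q\<close> strict.\<close>
    have "q + (e / 2 / norm u) *\<^sub>R u \<in> ball q e" using e False by (simp add: dist_norm)
    then have "u \<bullet> (q + (e / 2 / norm u) *\<^sub>R u) \<le> 1"
      using u e(2) by (auto simp: dual_polytope_def extreme_point_of_def)
    moreover have "(e / 2 / norm u) * (u \<bullet> u) > 0" using e False by simp
    ultimately have "u \<bullet> q < 1" by (simp add: inner_add_right)
    moreover have "u \<bullet> q \<in> \<int>" using integer_lattice_inner[OF int[OF u] q(2)] .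
    then obtain m where "u \<bullet> q = of_int m" by (elim Ints_cases)
    ultimately show ?thesis by simp
  qed simp
  then have "convex hull {u. u extreme_point_of ?D} \<subseteq> {u. q \<bullet> u \<le> 0}"
    by (intro hull_minimal convex_halfspace_le) (auto simp: inner_commute[of q])
  then have le: "?D \<subseteq> {u. q \<bullet> u \<le> 0}"
    using Krein_Milman_Minkowski[of ?D] \<open>polytope ?D\<close>
    by (simp add: polytope_imp_compact polytope_imp_convex)
  obtain e where e: "e > 0" "ball 0 e \<subseteq> ?D"
    using zero_in_interior_dual_polytope[OF \<open>bounded Q\<close>] mem_interior by blast
  have "(e / 2 / norm q) *\<^sub>R q \<in> ball 0 e" using e(1) \<open>q \<noteq> 0\<close> by simp
  then have "(e / 2 / norm q) *\<^sub>R q \<in> {u. q \<bullet> u \<le> 0}" using e(2) le by blast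
  then have "(e / 2 / norm q) * (q \<bullet> q) \<le> 0" by simp
  moreover have "(e / 2 / norm q) * (q \<bullet> q) > 0" using e(1) \<open>q \<noteq> 0\<close> by simp
  ultimately show False by simp
qed

text \<open>The families are the vertices of two simplices dual to each other, in which the origin
  has weights proportional to \<open>c\<close>. The product 1 for \<open>i \<noteq> k\<close> places
  \<open>u k\<close> on all dual facets but one; the value at \<open>i = k\<close> is then forced by
  \<open>sum_w\<close>.\<close>

locale dual_simplices =
  fixes w u :: "'i::finite \<Rightarrow> 'a::euclidean_space" and c :: "'i \<Rightarrow> real"
  assumes pos: "c i > 0"
    and inner: "u k \<bullet> w i = 1 - (if i = k then sum c UNIV / c k else 0)"
    and sum_w: "(\<Sum>i\<in>UNIV. c i *\<^sub>R w i) = 0"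
    and sep_w: "(\<And>i. w i \<bullet> z = 0) \<Longrightarrow> z = 0"
begin

lemma sum_c_pos: "sum c UNIV > 0"
  by (intro sum_pos) (auto simp: pos)

lemma sum_coordinates:
  "(\<Sum>k\<in>UNIV. (if i = k then sum c UNIV / c k else 0) * t k) = sum c UNIV / c i * t i"
  by (simp add: if_distrib[of "\<lambda>a. a * _"] cong: if_cong)

text \<open>The barycentric coordinates of a dual point are its slacks
  \<open>1 - x \<bullet> w k\<close>, scaled by \<open>c k / sum c UNIV\<close>;
  \<open>sum_w\<close> makes them add up to 1, and \<open>sep_w\<close> identifies the resulting
  combination with the point.\<close>

lemma dual_w: "dual_polytope (convex hull (range w)) = convex hull (range u)"
proof (intro subset_antisym subsetI)
  let ?C = "sum c UNIV"
  fix x assume x: "x \<in> dual_polytope (convex hull (range w))"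
  define t where "t k = (1 - x \<bullet> w k) * c k / ?C" for k
  have "t k \<ge> 0" for k
    using x pos[of k] sum_c_pos by (auto simp: t_def mem_dual_convex_hull_iff intro!: divide_nonneg_pos mult_nonneg_nonneg)
  moreover have t1: "sum t UNIV = 1"
  proof -
    have "sum t UNIV = (?C - x \<bullet> (\<Sum>i\<in>UNIV. c i *\<^sub>R w i)) / ?C"
      by (simp add: t_def inner_sum_right sum_subtractf right_diff_distrib mult.commute flip: sum_divide_distrib)
    then show ?thesis using sum_c_pos by (simp add: sum_w)
  qed
  moreover have "x = (\<Sum>k\<in>UNIV. t k *\<^sub>R u k)"
  proof -
    have "w i \<bullet> (x - (\<Sum>k\<in>UNIV. t k *\<^sub>R u k)) = 0" for i
    proof -
      have "w i \<bullet> (\<Sum>k\<in>UNIV. t k *\<^sub>R u k) = (\<Sum>k\<in>UNIV. t k * (u k \<bullet> w i))"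
        by (simp add: inner_sum_right inner_commute)
      also have "\<dots> = sum t UNIV - (\<Sum>k\<in>UNIV. (if i = k then ?C / c k else 0) * t k)"
        unfolding inner by (simp add: right_diff_distrib sum_subtractf mult.commute)
      also have "\<dots> = w i \<bullet> x"
        unfolding sum_coordinates t1 using pos[of i] sum_c_pos by (simp add: t_def inner_commute)
      finally show ?thesis by (simp add: inner_diff_right)
    qed
    then show ?thesis using sep_w by fastforce
  qed
  ultimately show "x \<in> convex hull (range u)"
    by (auto intro!: convex_sum simp: hull_inc)
next
  have "convex hull (range u) \<subseteq> dual_polytope (convex hull (range w))"
    using pos sum_c_pos
    by (intro hull_minimal) (auto simp: convex_dual_polytope mem_dual_convex_hull_iff inner less_imp_le)
  then show "x \<in> convex hull (range u) \<Longrightarrow> x \<in> dual_polytope (convex hull (range w))" for x by auto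
qed

text \<open>The delicate condition is separation by the \<open>u k\<close>. A vector orthogonal to
  all of them is expanded in the \<open>w i\<close>; its coefficients turn out proportional to
  \<open>c\<close>, so it vanishes by \<open>sum_w\<close>.\<close>

lemma swap: "dual_simplices u w c"
proof
  let ?C = "sum c UNIV"
  show "c i > 0" for i by (rule pos)
  show "w k \<bullet> u i = 1 - (if i = k then ?C / c k else 0)" for k i
    using inner[of i k] by (auto simp: inner_commute)
  have "w i \<bullet> (\<Sum>k\<in>UNIV. c k *\<^sub>R u k) = 0" for i
  proof -
    have "w i \<bullet> (\<Sum>k\<in>UNIV. c k *\<^sub>R u k) = (\<Sum>k\<in>UNIV. c k * (u k \<bullet> w i))"
      by (simp add: inner_sum_right inner_commute)
    also have "\<dots> = ?C - (\<Sum>k\<in>UNIV. (if i = k then ?C / c k else 0) * c k)"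
      unfolding inner by (simp add: right_diff_distrib sum_subtractf mult.commute)
    also have "\<dots> = 0" unfolding sum_coordinates using pos[of i] by simp
    finally show ?thesis .
  qed
  then show "(\<Sum>k\<in>UNIV. c k *\<^sub>R u k) = 0" by (rule sep_w)
  fix z assume z: "\<And>k. u k \<bullet> z = 0"
  have "span (range w) = UNIV"
    using span_not_UNIV_orthogonal[of "range w"] sep_w by (metis inner_commute rangeI span_base)
  then obtain b where "z = (\<Sum>v\<in>range w. b v *\<^sub>R v)"
    using span_finite[of "range w"] by auto
  \<comment> \<open>Injectivity turns a combination over the set \<open>range w\<close> into one
    indexed by \<open>i\<close>.\<close>
  moreover have "inj w"
  proof (rule injI, rule ccontr)
    fix i k assume "w i = w k" "i \<noteq> k"
    then show False using inner[of k i] inner[of k k] pos[of k] sum_c_pos by simp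
  qed
  ultimately obtain a where a: "z = (\<Sum>i\<in>UNIV. a i *\<^sub>R w i)"
    by (simp add: sum.reindex)
  have "a k * ?C / c k = sum a UNIV" for k
  proof -
    have "0 = (\<Sum>i\<in>UNIV. a i * (u k \<bullet> w i))"
      using z[of k] by (simp add: a inner_sum_right)
    also have "\<dots> = sum a UNIV - (\<Sum>i\<in>UNIV. (if k = i then ?C / c i else 0) * a i)"
      unfolding inner by (auto simp: right_diff_distrib sum_subtractf mult.commute intro!: sum.cong)
    finally show ?thesis unfolding sum_coordinates by simp
  qed
  then have "a k = (sum a UNIV / ?C) * c k" for k
    using pos[of k] sum_c_pos by (metis divide_eq_eq less_irrefl times_divide_eq_left)
  then have "z = (sum a UNIV / ?C) *\<^sub>R (\<Sum>i\<in>UNIV. c i *\<^sub>R w i)"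
    unfolding a scaleR_sum_right scaleR_scaleR by (metis (no_types, lifting) sum.cong)
  then show "z = 0" by (simp add: sum_w)
qed

text \<open>By \<open>swap\<close>, this simplex is itself the dual of a bounded set.\<close>

lemma zero_in_interior_w: "0 \<in> interior (convex hull (range w))"
proof -
  interpret swap: dual_simplices u w c by (rule swap)
  have "bounded (convex hull (range u))"
    by (simp add: finite_imp_bounded bounded_convex_hull)
  then show ?thesis using zero_in_interior_dual_polytope swap.dual_w by metis
qed

text \<open>The inequalities given by \<open>w i\<close> for \<open>i \<noteq> k\<close> are tight
  at \<open>u k\<close>, hence at both ends of a segment through it. By \<open>sum_w\<close> the
  ends also agree on \<open>w k\<close>, so they coincide.\<close>

lemma extreme_point_u: "u k extreme_point_of convex hull (range u)"
  unfolding extreme_point_of_def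
proof (intro conjI ballI notI)
  fix a b assume ab: "a \<in> convex hull (range u)" "b \<in> convex hull (range u)" "u k \<in> open_segment a b"
  then obtain t where t: "a \<noteq> b" "0 < t" "t < 1" "u k = (1 - t) *\<^sub>R a + t *\<^sub>R b"
    by (auto simp: in_segment)
  have le: "a \<bullet> w i \<le> 1" "b \<bullet> w i \<le> 1" for i
    using ab by (simp_all add: mem_dual_convex_hull_iff flip: dual_w)
  have eq: "a \<bullet> w i = 1 \<and> b \<bullet> w i = 1" if "i \<noteq> k" for i
  proof -
    have "(1 - t) * (1 - a \<bullet> w i) + t * (1 - b \<bullet> w i) = 1 - u k \<bullet> w i"
      by (simp add: t(4) inner_add_left algebra_simps)
    also have "\<dots> = 0" using that by (simp add: inner)
    finally have "(1 - t) * (1 - a \<bullet> w i) = 0 \<and> t * (1 - b \<bullet> w i) = 0"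
      using le[of i] t by (subst (asm) add_nonneg_eq_0_iff) auto
    then show ?thesis using t by simp
  qed
  have "w i \<bullet> (a - b) = 0" if "i \<noteq> k" for i
    using eq[OF that] by (simp add: inner_diff_right inner_commute)
  moreover have "w k \<bullet> (a - b) = 0"
  proof -
    have "0 = (\<Sum>i\<in>UNIV. c i *\<^sub>R w i) \<bullet> (a - b)" by (simp add: sum_w)
    also have "\<dots> = (\<Sum>i\<in>UNIV. c i * (w i \<bullet> (a - b)))" by (simp add: inner_sum_left)
    also have "\<dots> = c k * (w k \<bullet> (a - b))"
      using calculation by (subst sum.remove[of _ k]) (auto simp: \<open>\<And>i. i \<noteq> k \<Longrightarrow> w i \<bullet> (a - b) = 0\<close>)
    finally show ?thesis using pos[of k] by simp
  qed
  ultimately have "a - b = 0" by (intro sep_w) metis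
  then show False using t by simp
qed (simp add: hull_inc)

end

section \<open>The Laplacian simplex\<close>

lemma affine_hull_integer_lattice: "affine hull (integer_lattice :: (real ^ 'd) set) = UNIV"
proof -
  have "x \<in> span integer_lattice" for x :: "real ^ 'd"
  proof -
    have "(\<Sum>i\<in>UNIV. x $ i *\<^sub>R axis i 1) \<in> span integer_lattice"
      by (intro span_sum span_scale span_base) simp
    then show ?thesis using basis_expansion[of x] by (simp add: scalar_mult_eq_scaleR)
  qed
  then show ?thesis
    using affine_hull_span_0[of "integer_lattice :: (real ^ 'd) set"] by (auto simp: hull_inc)
qed

lemma affine_hull_zero_sum_lattice:
  "affine hull (zero_sum_lattice :: (real ^ 'n) set) = {x. (\<Sum>i\<in>UNIV. x $ i) = 0}" (is "_ = ?V")
proof -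
  let ?\<Lambda> = "zero_sum_lattice :: (real ^ 'n) set"
  have "0 \<in> ?\<Lambda>" by (simp add: zero_sum_lattice_def)
  then have "affine hull ?\<Lambda> = span ?\<Lambda>" by (simp add: affine_hull_span_0 hull_inc)
  also have "\<dots> = ?V"
  proof (rule span_unique)
    show "?\<Lambda> \<subseteq> ?V" by (auto simp: zero_sum_lattice_def)
    show "subspace ?V"
      by (auto simp: subspace_def sum.distrib simp flip: sum_distrib_left)
    fix S assume S: "?\<Lambda> \<subseteq> S" "subspace S"
    show "?V \<subseteq> S"
    proof
      fix x assume "x \<in> ?V"
      \<comment> \<open>Any fixed index can serve as base: since the coordinates of \<open>x\<close>
        sum to zero, \<open>x\<close> is a combination of differences of unit vectors with the base
        vector.\<close>
      let ?j = "undefined :: 'n"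
      have "(\<Sum>m\<in>UNIV. axis i 1 $ m) = (1 :: real)" for i :: 'n
        unfolding axis_def by simp
      then have diff: "axis i 1 - axis ?j 1 \<in> ?\<Lambda>" for i
        by (simp add: zero_sum_lattice_def sum_subtractf integer_lattice_diff)
      have "(\<Sum>i\<in>UNIV. x $ i *\<^sub>R (axis i 1 - axis ?j 1)) =
          (\<Sum>i\<in>UNIV. x $ i *\<^sub>R axis i 1) - (\<Sum>i\<in>UNIV. x $ i) *\<^sub>R axis ?j 1"
        by (simp add: scaleR_diff_right sum_subtractf scaleR_sum_left)
      also have "\<dots> = x"
        using basis_expansion[of x] \<open>x \<in> ?V\<close> by (simp add: scalar_mult_eq_scaleR)
      finally have "x = (\<Sum>i\<in>UNIV. x $ i *\<^sub>R (axis i 1 - axis ?j 1))" by simp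
      also have "\<dots> \<in> S" using S diff by (intro subspace_sum subspace_scale) auto
      finally show "x \<in> S" .
    qed
  qed
  finally show ?thesis .
qed

lemma inner_ones: "(\<chi> i. t) \<bullet> x = t * (\<Sum>i\<in>UNIV. x $ i)" for x :: "real ^ 'n"
  by (simp add: inner_vec_def sum_distrib_left)

lemma laplacian_row_zero_sum_lattice:
  fixes D :: "('n::finite, 'e) pre_digraph"
  assumes "fin_digraph D"
  shows "laplacian D $ i \<in> zero_sum_lattice"
proof -
  have "laplacian D $ i \<bullet> (\<chi> i. 1) = 0"
    using laplacian_mult_const[OF assms, of 1] by (metis matrix_vector_mul_component zero_index)
  then have "(\<Sum>j\<in>UNIV. laplacian D $ i $ j) = 0"
    using inner_ones[of 1 "laplacian D $ i"] by (simp add: inner_commute)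
  then show ?thesis using laplacian_row_integer[OF assms] by (simp add: zero_sum_lattice_def)
qed

text \<open>The map \<open>f\<close> turns the zero-sum hyperplane into a full-dimensional space,
  and the adjoint of its inverse \<open>g\<close> moves the products of rows with \<open>y k\<close>
  there. Leaving \<open>f\<close> arbitrary covers both a given equivalence and a coordinate
  projection.\<close>

lemma laplacian_dual_simplices:
  fixes D :: "('n::finite, 'e) pre_digraph" and f :: "real ^ 'n \<Rightarrow> 'a::euclidean_space"
  defines "c \<equiv> \<lambda>i. real (tree_count D i)" and "V \<equiv> {x. (\<Sum>i\<in>UNIV. x $ i) = 0}"
  assumes D: "fin_digraph D" "verts D = UNIV" and pos: "\<And>i. tree_count D i \<noteq> 0"
    and f: "linear f" "f ` V = UNIV" and g: "linear g" "\<And>v. v \<in> V \<Longrightarrow> g (f v) = v"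
    and y: "\<And>k. laplacian D *v y k = (\<chi> i. 1 - (if i = k then sum c UNIV / c k else 0))"
  shows "dual_simplices (\<lambda>i. f (laplacian D $ i)) (\<lambda>k. adjoint g (y k)) c"
proof
  show "c i > 0" for i using pos[of i] by (simp add: c_def)
  have row: "laplacian D $ i \<in> V" for i
    using laplacian_row_zero_sum_lattice[OF D(1)] by (auto simp: V_def zero_sum_lattice_def)
  show "adjoint g (y k) \<bullet> f (laplacian D $ i) = 1 - (if i = k then sum c UNIV / c k else 0)" for i k
  proof -
    have "adjoint g (y k) \<bullet> f (laplacian D $ i) = laplacian D $ i \<bullet> y k"
      using adjoint_works[OF g(1), of "f (laplacian D $ i)" "y k"] g(2)[OF row] by (simp add: inner_commute)
    also have "\<dots> = (laplacian D *v y k) $ i" by (simp add: matrix_vector_mul_component)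
    finally show ?thesis by (simp add: y)
  qed
  have "(\<Sum>i\<in>UNIV. c i *\<^sub>R f (laplacian D $ i)) = f (\<Sum>i\<in>UNIV. c i *\<^sub>R laplacian D $ i)"
    by (simp add: linear_sum[OF f(1)] linear_scale[OF f(1)])
  then show "(\<Sum>i\<in>UNIV. c i *\<^sub>R f (laplacian D $ i)) = 0"
    using tree_count_left_kernel[OF D pos] linear_0[OF f(1)] by (simp add: c_def)
  fix z assume z: "\<And>i. f (laplacian D $ i) \<bullet> z = 0"
  obtain v where v: "v \<in> V" "f v = z" using f(2) by (metis UNIV_I image_iff)
  let ?r = "undefined :: 'n"
  \<comment> \<open>This vector is orthogonal to all rows, hence constant and orthogonal to
    \<open>V\<close>. As \<open>z\<close> is the image of some \<open>v\<close> in \<open>V\<close>,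
    it is orthogonal to itself.\<close>
  let ?t = "adjoint f z"
  have "laplacian D *v ?t = 0"
    using z by (simp add: vec_eq_iff matrix_vector_mul_component adjoint_works[OF f(1)])
  then have "?t = (\<chi> i. ?t $ ?r)"
    using laplacian_kernel[OF D pos] by (metis vec_eq_iff vec_lambda_beta)
  then have "?t \<bullet> v = 0" using inner_ones[of "?t $ ?r" v] v(1) by (simp add: V_def)
  then have "z \<bullet> z = 0" using adjoint_works[OF f(1), of v z] v(2) by (simp add: inner_commute)
  then show "z = 0" by simp
qed

text \<open>The deleted coordinate \<open>j\<close> is recovered as minus the sum of the others,
  which preserves integrality; \<open>h\<close> relabels the remaining indices by
  \<open>'d\<close>.\<close>

lemma coordinate_projection_zero_sum:
  fixes h :: "'d::finite \<Rightarrow> 'n::finite" and j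
  defines "V \<equiv> {x :: real ^ 'n. (\<Sum>i\<in>UNIV. x $ i) = 0}" and "f \<equiv> \<lambda>x :: real ^ 'n. \<chi> i. x $ h i"
  assumes h: "bij_betw h UNIV (- {j})"
  shows "linear f" and "bij_betw f V UNIV" and "f ` zero_sum_lattice = integer_lattice"
proof -
  show "linear f" by (rule linearI) (simp_all add: f_def vec_eq_iff)
  have sum_h: "(\<Sum>i\<in>UNIV. x $ i) = x $ j + (\<Sum>i\<in>UNIV. x $ h i)" for x :: "real ^ 'n"
  proof -
    have "(\<Sum>i\<in>UNIV. x $ h i) = (\<Sum>i\<in>- {j}. x $ i)"
      by (rule sum.reindex_bij_betw[OF h])
    then show ?thesis by (simp add: sum.remove[of UNIV j] Compl_eq_Diff_UNIV)
  qed
  have inj_h: "inj h" and j_h: "h i \<noteq> j" for i using h by (auto simp: bij_betw_def)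
  define e where "e z = (\<chi> k. if k = j then - (\<Sum>i\<in>UNIV. z $ i) else z $ inv h k)" for z :: "real ^ 'd"
  have fe: "f (e z) = z" for z
    by (simp add: f_def e_def vec_eq_iff j_h inj_h)
  have eV: "e z \<in> V" for z
    by (simp add: V_def sum_h) (simp add: e_def j_h inj_h)
  have ef: "e (f x) = x" if "x \<in> V" for x
  proof -
    have "e (f x) $ k = x $ k" for k
    proof (cases "k = j")
      case True
      then show ?thesis using that by (simp add: e_def f_def V_def sum_h)
    next
      case False
      then have "k \<in> range h" using h by (auto simp: bij_betw_def)
      then show ?thesis using False by (simp add: e_def f_def f_inv_into_f)
    qed
    then show ?thesis by (simp add: vec_eq_iff)
  qed
  show "bij_betw f V UNIV"
    by (rule bij_betw_byWitness[where f' = e]) (auto simp: fe ef eV)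
  show "f ` zero_sum_lattice = integer_lattice"
  proof (intro subset_antisym subsetI)
    fix z assume "z \<in> f ` zero_sum_lattice"
    then show "z \<in> integer_lattice" by (auto simp: zero_sum_lattice_def integer_lattice_def f_def)
  next
    fix z :: "real ^ 'd" assume "z \<in> integer_lattice"
    then have "e z \<in> integer_lattice"
      by (auto simp: integer_lattice_def e_def intro!: Ints_sum)
    then have "e z \<in> zero_sum_lattice" using eV[of z] by (simp add: zero_sum_lattice_def V_def)
    then show "z \<in> f ` zero_sum_lattice" using fe by (metis image_eqI)
  qed
qed

section \<open>Reflexivity and divisibility of the tree counts\<close>

lemma lattice_polytope_convex_hull:
  assumes "finite S" "S \<subseteq> \<Lambda>"
  shows "lattice_polytope \<Lambda> (convex hull S)"
  using assms extreme_points_of_convex_hull[of S]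
  by (auto simp: lattice_polytope_def polytope_def)

theorem corollary10:
  fixes D :: "('n::finite, 'e) pre_digraph"
  assumes "fin_digraph D" and "loopfree_digraph D"
    and "verts D = UNIV"
    and "\<forall>i. \<not> (in_degree D i = 0 \<and> out_degree D i = 0)"
    and "strongly_connected D"
    and "Gcd (range (tree_count D)) = 1"
    and "CARD('n) = CARD('d::finite) + 1"
  shows "reflexive_polytope TYPE('d) zero_sum_lattice (laplacian_polytope D)
           \<longleftrightarrow> (\<forall>i. tree_count D i dvd total_tree_count D)"
proof
  note D = assms(1,3)
  let ?L = "laplacian D"
  let ?V = "{x :: real ^ 'n. (\<Sum>i\<in>UNIV. x $ i) = 0}"
  define c where "c = (\<lambda>i. real (tree_count D i))"
  let ?C = "sum c UNIV"
  have C: "?C = real (total_tree_count D)"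
    by (simp add: c_def total_tree_count_def D(2))
  obtain r where "tree_count D r \<noteq> 0"
  proof -
    have "\<not> range (tree_count D) \<subseteq> {0}" using assms(6) by (metis Gcd_0_iff zero_neq_one)
    then show thesis using that by blast
  qed
  then have pos: "tree_count D i \<noteq> 0" for i
    using tree_count_pos[OF D assms(5)] by (metis less_irrefl)
  then have c_pos: "c i > 0" for i by (simp add: c_def)
  have ints: "real (tree_count D k) \<in> \<int>" for k by simp
  \<comment> \<open>This is the value that the Laplacian must take to produce the dual vertex
    \<open>u k\<close>; its orthogonality to \<open>c\<close> permits solving for that
    vertex.\<close>
  define b where "b k = (\<chi> i. 1 - (if i = k then ?C / c k else 0))" for k
  have c_b: "(\<Sum>i\<in>UNIV. c i * b k $ i) = 0" for k
  proof -
    have "(\<Sum>i\<in>UNIV. c i * b k $ i) = (\<Sum>i\<in>UNIV. c i - (if i = k then ?C else 0))"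
      using c_pos[of k] by (intro sum.cong) (auto simp: b_def right_diff_distrib)
    then show ?thesis by (simp add: sum_subtractf)
  qed
  have P: "laplacian_polytope D = convex hull (range (\<lambda>i. ?L $ i))"
    by (simp add: laplacian_polytope_def rows_def row_def full_SetCompr_eq)
  have row: "?L $ i \<in> zero_sum_lattice" for i
    by (rule laplacian_row_zero_sum_lattice[OF D(1)])
  have subspace_V: "subspace ?V"
    by (auto simp: subspace_def sum.distrib simp flip: sum_distrib_left)
  {
    assume "reflexive_polytope TYPE('d) zero_sum_lattice (laplacian_polytope D)"
    then obtain Q :: "(real ^ 'd) set" and f a where Q: "standard_reflexive Q" and f: "linear f"
      and bij: "bij_betw (\<lambda>x. f x + a) ?V UNIV"
      and lat: "(\<lambda>x. f x + a) ` zero_sum_lattice = integer_lattice"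
      and fP: "(\<lambda>x. f x + a) ` laplacian_polytope D = Q"
      unfolding reflexive_polytope_def unimodularly_equivalent_def affine_hull_integer_lattice
        affine_hull_zero_sum_lattice by blast
    have fV: "f ` ?V = UNIV"
    proof -
      have "z \<in> f ` ?V" for z
      proof -
        have "z + a \<in> (\<lambda>x. f x + a) ` ?V" using bij by (simp add: bij_betw_def)
        then show ?thesis by auto
      qed
      then show ?thesis by auto
    qed
    have "inj_on f ?V" using bij by (auto simp: bij_betw_def inj_on_def)
    then obtain g where g: "linear g" "\<And>v. v \<in> ?V \<Longrightarrow> g (f v) = v"
      using linear_exists_left_inverse_on[OF f subspace_V] by blast
    have "\<exists>y. ?L *v y = b k" for k
    proof -
      \<comment> \<open>Multiplying by \<open>c k\<close> clears the denominator; a real solution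
        suffices here, so the factor is divided out afterwards.\<close>
      have "c k *\<^sub>R b k \<in> integer_lattice"
        using c_pos[of k] ints by (auto simp: integer_lattice_def b_def right_diff_distrib c_def)
      moreover have "(\<Sum>i\<in>UNIV. real (tree_count D i) * (c k *\<^sub>R b k) $ i) = c k * (\<Sum>i\<in>UNIV. c i * b k $ i)"
        unfolding sum_distrib_left by (intro sum.cong) (simp_all add: c_def)
      ultimately obtain y where "?L *v y = c k *\<^sub>R b k"
        using laplacian_integer_solution[OF D pos assms(6)] c_b by (metis mult_zero_right)
      then have "?L *v ((1 / c k) *\<^sub>R y) = b k" using c_pos[of k] by (simp add: matrix_vector_mult_scaleR)
      then show ?thesis by blast
    qed
    then obtain y where y: "\<And>k. ?L *v y k = b k" by metis
    define w u where "w i = f (?L $ i)" and "u k = adjoint g (y k)" for i k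
    interpret dual_simplices w u c
      unfolding w_def u_def c_def
      by (rule laplacian_dual_simplices[OF D pos f fV g]) (auto simp: y b_def c_def)
    have image: "f ` laplacian_polytope D = convex hull (range w)"
      unfolding P convex_hull_linear_image[OF f] by (simp add: image_image w_def)
    have Q_eq: "Q = (+) a ` (convex hull (range w))"
      unfolding fP[symmetric] image[symmetric] by (simp add: image_image add.commute)
    \<comment> \<open>The translation vector is the image of the origin, an interior lattice point
      of the Laplacian simplex relative to its hyperplane.\<close>
    have "a \<in> interior Q"
      using zero_in_interior_w unfolding Q_eq interior_translation by (metis add.right_neutral image_eqI)
    moreover have "a \<in> integer_lattice"
    proof -
      have "f 0 + a \<in> integer_lattice" unfolding lat[symmetric]
        by (rule imageI) (simp add: zero_sum_lattice_def)
      then show ?thesis by (simp add: linear_0[OF f])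
    qed
    ultimately have "a = 0" by (rule standard_reflexive_interior_lattice_point[OF Q])
    show "\<forall>i. tree_count D i dvd total_tree_count D"
    proof
      fix k
      have "dual_polytope Q = convex hull (range u)" using \<open>a = 0\<close> by (simp add: Q_eq dual_w)
      then have "u k \<in> integer_lattice"
        using Q extreme_point_u[of k] by (auto simp: standard_reflexive_def lattice_polytope_def)
      \<comment> \<open>Integrality of both vertices is used only through their product, which
        equals \<open>1 - ?C / c k\<close>.\<close>
      moreover have "w k \<in> integer_lattice"
        unfolding lat[symmetric] w_def using row[of k] \<open>a = 0\<close> by auto
      ultimately have "u k \<bullet> w k \<in> \<int>" by (rule integer_lattice_inner)
      then have "1 - ?C / c k \<in> \<int>" by (simp add: inner)
      then have "1 - (1 - ?C / c k) \<in> \<int>" by (intro Ints_diff) auto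
      then obtain m where "?C / c k = of_int m" by (auto elim: Ints_cases)
      then have "?C = of_int m * c k" using c_pos[of k] by (simp add: field_simps)
      then have "real (total_tree_count D) = of_int m * real (tree_count D k)"
        unfolding C by (simp add: c_def)
      then have "int (total_tree_count D) = m * int (tree_count D k)"
        by (metis of_int_eq_iff of_int_mult of_int_of_nat_eq)
      then show "tree_count D k dvd total_tree_count D"
        by (metis dvd_triv_right int_dvd_int_iff)
    qed
  }
  {
    assume dvd: "\<forall>i. tree_count D i dvd total_tree_count D"
    define j :: 'n where "j = undefined"
    have "card (- {j}) = CARD('d)" using assms(7) by (simp add: Compl_eq_Diff_UNIV)
    then obtain h :: "'d \<Rightarrow> 'n" where h: "bij_betw h UNIV (- {j})"
      by (metis finite_same_card_bij finite)
    define f where "f = (\<lambda>x :: real ^ 'n. (\<chi> i. x $ h i) :: real ^ 'd)"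
    note f = coordinate_projection_zero_sum[OF h, folded f_def]
    have "inj_on f ?V" "f ` ?V = UNIV" using f(2) by (auto simp: bij_betw_def)
    then obtain g where g: "linear g" "\<And>v. v \<in> ?V \<Longrightarrow> g (f v) = v"
      using linear_exists_left_inverse_on[OF f(1) subspace_V] by blast
    have "\<exists>y \<in> integer_lattice. ?L *v y = b k" for k
    proof -
      obtain m where "total_tree_count D = tree_count D k * m" using dvd by blast
      then have "?C / c k = real m" using c_pos[of k] unfolding C by (simp add: c_def)
      \<comment> \<open>Divisibility enters here: the right-hand side is integral, and so is the
        solution \<open>y k\<close>.\<close>
      then have "b k \<in> integer_lattice" by (auto simp: integer_lattice_def b_def)
      moreover have "(\<Sum>i\<in>UNIV. real (tree_count D i) * b k $ i) = 0"
        using c_b[of k] by (simp only: c_def)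
      ultimately obtain y where "y \<in> integer_lattice" "?L *v y = b k"
        by (rule laplacian_integer_solution[OF D pos assms(6)])
      then show ?thesis by blast
    qed
    then obtain y where y: "\<And>k. y k \<in> integer_lattice" "\<And>k. ?L *v y k = b k" by metis
    define w u where "w i = f (?L $ i)" and "u k = adjoint g (y k)" for i k
    interpret dual_simplices w u c
      unfolding w_def u_def c_def
      by (rule laplacian_dual_simplices[OF D pos f(1) \<open>f ` ?V = UNIV\<close> g]) (auto simp: y b_def c_def)
    have w_lat: "w i \<in> integer_lattice" for i
      unfolding f(3)[symmetric] w_def using row by blast
    have u_lat: "u k \<in> integer_lattice" for k
    proof -
      have "u k $ i \<in> \<int>" for i
      proof -
        \<comment> \<open>Coordinate \<open>i\<close> of \<open>u k\<close> is the product of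
          \<open>y k\<close> with the lattice vector that projects to the unit vector
          \<open>axis i 1\<close>.\<close>
        obtain v where v: "v \<in> zero_sum_lattice" "f v = axis i 1"
          using f(3) integer_lattice_axis by (metis imageE)
        then have "g (axis i 1) = v" using g(2)[of v] by (auto simp: zero_sum_lattice_def)
        then have "axis i 1 \<bullet> u k = v \<bullet> y k" using adjoint_works[OF g(1)] by (simp add: u_def)
        then show ?thesis
          using v(1) y(1) integer_lattice_inner[of v "y k"] by (simp add: inner_axis' zero_sum_lattice_def)
      qed
      then show ?thesis by (simp add: integer_lattice_def)
    qed
    have "f ` laplacian_polytope D = convex hull (range w)"
      unfolding P convex_hull_linear_image[OF f(1)] by (simp add: image_image w_def)
    then have "unimodularly_equivalent zero_sum_lattice (laplacian_polytope D) integer_lattice (convex hull (range w))"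
      unfolding unimodularly_equivalent_def affine_hull_integer_lattice affine_hull_zero_sum_lattice
      using f by (intro exI[of _ f] exI[of _ 0]) simp
    moreover have "standard_reflexive (convex hull (range w))"
      unfolding standard_reflexive_def dual_w using w_lat u_lat zero_in_interior_w
      by (auto intro!: lattice_polytope_convex_hull)
    moreover have "lattice_polytope zero_sum_lattice (laplacian_polytope D)"
      unfolding P using row by (intro lattice_polytope_convex_hull) auto
    ultimately show "reflexive_polytope TYPE('d) zero_sum_lattice (laplacian_polytope D)"
      unfolding reflexive_polytope_def by blast
  }
qed

end
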